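(* For $n\ge1$ let $\mathrm{int}(n)=\sum_{w\in\mathcal{M}_n}\mathrm{inter}(w)$ be the total number of interior points over all Motzkin polyominoes of length $n$. Then $$\sum_{n\ge1}\mathrm{int}(n)\,x^n=\frac{2 - 3 x - 5 x^2 -(2-x-2x^2)\sqrt{1 - 2 x - 3 x^2}}{2 x (1 + x) (1 - 3 x)},$$ and $\mathrm{int}(n)\sim 3^n/2$ as $n\to\infty$. Moreover, the expected number of interior points of a uniformly random Motzkin polyomino of length $n$, namely $\mathrm{int}(n)/|\mathcal{M}_n|$, is asymptotically equivalent to $\sqrt{\frac{\pi}{3}}\,n^{3/2}$ as $n\to\infty$.
   Context: A Motzkin word of length $n\ge 1$ is a word $w=w_1\cdots w_n$ over the positive integers such that $w_1=1$, and $1\le w_k\le w_{k-1}+1$ and $w_{k-1}\ne w_k$ for $k=2,\dots,n$; $\mathcal{M}_n$ is the set of Motzkin words of length $n$. To $w$ one associates the Motzkin polyomino $P(w)$ of length $n$ with $n$ columns, all bottom-justified, whose $i$-th column consists of $w_i$ unit cells. An interior point of $P(w)$ is a point that belongs to exactly four cells of $P(w)$, and $\mathrm{inter}(w)$ is the number of interior points of $P(w)$. *)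

theory Defs
  imports
    "HOL-Probability.Probability"
    "HOL-Computational_Algebra.Formal_Power_Series"
    "HOL-Library.Landau_Symbols"
begin

(* Lists are indexed from 0, so w ! k is the letter w_{k+1} of the word w. *)
definition motzkin_word :: "nat list \<Rightarrow> bool" where
  "motzkin_word w \<longleftrightarrow>
     length w \<ge> 1 \<and> w ! 0 = 1 \<and>
     (\<forall>k. 1 \<le> k \<and> k < length w \<longrightarrow>
        1 \<le> w ! k \<and> w ! k \<le> w ! (k - 1) + 1 \<and> w ! (k - 1) \<noteq> w ! k)"

definition motzkin_words :: "nat \<Rightarrow> nat list set" where
  "motzkin_words n = {w. motzkin_word w \<and> length w = n}"

(* Cells are closed unit squares, so neighbouring cells share boundary points. *)
definition cell :: "nat \<Rightarrow> nat \<Rightarrow> (real \<times> real) set" where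
  "cell i j = {real i..real i + 1} \<times> {real j..real j + 1}"

(* A polyomino is represented by its set of cells, the bottom of every column lying on
   the horizontal axis. *)
definition polyomino :: "nat list \<Rightarrow> (real \<times> real) set set" where
  "polyomino w = {cell i j | i j. i < length w \<and> j < w ! i}"

definition interior_points :: "nat list \<Rightarrow> (real \<times> real) set" where
  "interior_points w = {p. card {c \<in> polyomino w. p \<in> c} = 4}"

definition num_interior :: "nat list \<Rightarrow> nat" where
  "num_interior w = card (interior_points w)"

definition total_interior :: "nat \<Rightarrow> nat" where
  "total_interior n = (\<Sum>w\<in>motzkin_words n. num_interior w)"

end

theory Submission
  imports Defs "HOL-Real_Asymp.Real_Asymp"
begin

text \<open>
  Four cells of a bottom-justified polyomino meet exactly at the lattice points that lie strictly
  inside two adjacent columns, so a word \<open>w\<close> has \<open>\<Sum> (min w\<^sub>i w\<^sub>i\<^sub>+\<^sub>1 - 1)\<close> interior points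
  (\<open>num_interior_eq_sum\<close>).

  A Motzkin word of length at least 2 is cut before the second occurrence of the letter 1 (if there
  is one): it is \<open>1 # map Suc u @ v\<close> for a unique Motzkin word \<open>u\<close> and a unique \<open>v\<close> that is empty or
  Motzkin.  The block \<open>u\<close> cannot be empty because adjacent letters differ.  Raising \<open>u\<close> by one unit
  adds one interior point for each of its \<open>length u - 1\<close> adjacent pairs, and nothing is gained next
  to a letter 1.  With \<open>M\<close> for the generating function of the words and \<open>I\<close> for that of the interior
  points, this gives
  \<open>M = x (1 + M + M\<^sup>2)\<close>  and  \<open>I = x ((I + x M' - M) (1 + M) + M I)\<close>.

  Put \<open>S = 1 - x - 2 x M\<close>.  The first equation says \<open>S\<^sup>2 = 1 - 2 x - 3 x\<^sup>2\<close>, and its derivative gives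
  \<open>x M' S = M\<close>.  The second one reads \<open>I S = x (x M' - M) (1 + M)\<close>, whence
  \<open>I S\<^sup>2 = (M - x) (1 - S)\<close>, which is the closed form.

  For the asymptotics, \<open>S\<^sup>2 = (1 + x) (1 - 3 x)\<close> turns the closed form into
  \<open>2 x I = (2 - 5 x) / (1 - 3 x) - (2 - x - 2 x\<^sup>2) / S\<close>.  The first summand contributes exactly
  \<open>3\<^sup>n / 2\<close> to the coefficient of \<open>x\<^sup>n\<close> in \<open>I\<close>, and the second is negligible because the
  coefficients of \<open>1 / S\<close> are of order \<open>3\<^sup>n n\<^sup>-\<^sup>1\<^sup>/\<^sup>2\<close>.  The number of words is
  \<open>- 1 / 2\<close> times a coefficient of \<open>S\<close>.  Both \<open>S\<close> and \<open>1 / S\<close> are powers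
  \<open>((1 + x) (1 - 3 x))\<^sup>a\<close>, and \<open>quadratic_power_asymptotics\<close> treats them together: the dominant
  singularity is at \<open>x = 1 / 3\<close>, where the other factor takes the value \<open>(4 / 3)\<^sup>a\<close>.
\<close>

unbundle no vec_syntax
unbundle fps_syntax

section \<open>Interior points as a sum over adjacent columns\<close>
lemma cell_inj: "cell i j = cell i' j' \<Longrightarrow> i = i' \<and> j = j'"
  unfolding cell_def by (auto simp: times_eq_iff)

text \<open>
  A point lies in at most two columns and at most two rows of cells, so four cells can meet there only
  if both coordinates are integers and all four surrounding cells belong to the polyomino.  The
  lower row then has index \<open>j - 1 \<ge> 0\<close>, and the upper row \<open>j\<close> must be present in both columns.
\<close>
lemma interior_points_eq:
  "interior_points w =
     (\<lambda>(i, j). (real (Suc i), real j)) `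
       (SIGMA i:{..<length w - 1}. {1..<min (w ! i) (w ! Suc i)})"
proof (intro equalityI subsetI)
  fix p assume p: "p \<in> interior_points w"
  obtain x y where xy: "p = (x, y)" by (cases p)
  define E where "E = {(i, j). i < length w \<and> j < w ! i \<and> p \<in> cell i j}"
  have img: "{c \<in> polyomino w. p \<in> c} = (\<lambda>(i, j). cell i j) ` E"
    unfolding E_def polyomino_def by auto
  have inj: "inj_on (\<lambda>(i, j). cell i j) E"
    by (auto simp: inj_on_def dest: cell_inj)
  have "card {c \<in> polyomino w. p \<in> c} = 4"
    using p unfolding interior_points_def by simp
  hence cardE: "card E = 4"
    unfolding img card_image[OF inj] .
  \<comment> \<open>The candidate columns are \<open>f - 1\<close> and \<open>f\<close>; for \<open>f = 0\<close> truncated subtraction merges them, which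
    leaves too few cells.\<close>
  define f where "f = nat \<lfloor>x\<rfloor>"
  define g where "g = nat \<lfloor>y\<rfloor>"
  have near: "n = nat \<lfloor>z\<rfloor> - 1 \<or> n = nat \<lfloor>z\<rfloor>" if "real n \<le> z" "z \<le> real n + 1" for n z
  proof -
    have "int n \<le> \<lfloor>z\<rfloor>" "\<lfloor>z\<rfloor> \<le> int n + 1"
      using that by (simp_all add: le_floor_iff floor_le_iff)
    thus ?thesis by linarith
  qed
  have sub: "E \<subseteq> {f - 1, f} \<times> {g - 1, g}"
    unfolding E_def f_def g_def xy cell_def using near by auto
  have le4: "card ({f - 1, f} \<times> {g - 1, g}) \<le> card E"
    unfolding cardE card_cartesian_product
    using mult_le_mono[of "card {f - 1, f}" 2 "card {g - 1, g}" 2]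
    by (simp add: card_insert_if)
  hence E: "E = {f - 1, f} \<times> {g - 1, g}"
    using card_seteq[OF _ sub] by simp
  with cardE have pos: "f \<ge> 1" "g \<ge> 1"
    by (cases f; cases g; simp add: card_cartesian_product card_insert_if)+
  from E have "(f - 1, g - 1) \<in> E" "(f - 1, g) \<in> E" "(f, g) \<in> E"
    by auto
  with pos have "x = real f" "y = real g" "f < length w" "g < w ! f" "g < w ! (f - 1)"
    unfolding E_def xy cell_def by (auto simp: of_nat_diff)
  with pos xy show "p \<in> (\<lambda>(i, j). (real (Suc i), real j)) `
       (SIGMA i:{..<length w - 1}. {1..<min (w ! i) (w ! Suc i)})"
    by (intro image_eqI[of _ _ "(f - 1, g)"]) auto
next
  fix p assume "p \<in> (\<lambda>(i, j). (real (Suc i), real j)) `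
       (SIGMA i:{..<length w - 1}. {1..<min (w ! i) (w ! Suc i)})"
  then obtain i j where p: "p = (real (Suc i), real j)"
    and ij: "Suc i < length w" "1 \<le> j" "j < w ! i" "j < w ! Suc i"
    by auto
  have "{c \<in> polyomino w. p \<in> c} = (\<lambda>(i, j). cell i j) ` ({i, Suc i} \<times> {j - 1, j})"
  proof (intro equalityI subsetI)
    fix c assume "c \<in> {c \<in> polyomino w. p \<in> c}"
    then obtain i' j' where c: "c = cell i' j'" "p \<in> cell i' j'"
      unfolding polyomino_def by auto
    hence "real i' \<le> real (Suc i)" "real (Suc i) \<le> real (Suc i')"
      "real j' \<le> real j" "real j \<le> real (Suc j')"
      unfolding p cell_def by auto
    hence "i' = i \<or> i' = Suc i" "j' = j - 1 \<or> j' = j"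
      unfolding of_nat_le_iff by auto
    thus "c \<in> (\<lambda>(i, j). cell i j) ` ({i, Suc i} \<times> {j - 1, j})"
      using c by auto
  next
    fix c assume "c \<in> (\<lambda>(i, j). cell i j) ` ({i, Suc i} \<times> {j - 1, j})"
    then obtain i' j' where c: "c = cell i' j'" "i' = i \<or> i' = Suc i" "j' = j - 1 \<or> j' = j"
      by auto
    hence "i' < length w" "j' < w ! i'" using ij by auto
    moreover have "p \<in> cell i' j'"
      using c ij unfolding p cell_def by (auto simp: of_nat_diff)
    ultimately show "c \<in> {c \<in> polyomino w. p \<in> c}"
      using c unfolding polyomino_def by auto
  qed
  moreover have "inj_on (\<lambda>(i, j). cell i j) ({i, Suc i} \<times> {j - 1, j})"
    by (auto simp: inj_on_def dest: cell_inj)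
  ultimately show "p \<in> interior_points w"
    unfolding interior_points_def using ij
    by (simp add: card_image card_cartesian_product card_insert_if)
qed

lemma num_interior_eq_sum:
  "num_interior w = (\<Sum>i<length w - 1. min (w ! i) (w ! Suc i) - 1)"
proof -
  have "inj_on (\<lambda>(i, j). (real (Suc i), real j))
          (SIGMA i:{..<length w - 1}. {1..<min (w ! i) (w ! Suc i)})"
    by (auto simp: inj_on_def)
  thus ?thesis
    unfolding num_interior_def interior_points_eq by (simp add: card_image)
qed

lemma num_interior_Nil [simp]: "num_interior [] = 0"
  and num_interior_singleton [simp]: "num_interior [x] = 0"
  by (simp_all add: num_interior_eq_sum)

lemma num_interior_Cons_Cons:
  "num_interior (x # y # zs) = min x y - 1 + num_interior (y # zs)"
  by (simp add: num_interior_eq_sum sum.lessThan_Suc_shift del: sum.lessThan_Suc)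

text \<open>
  The junction contributes nothing, since the smaller of its two columns has height at most 1.
\<close>
lemma num_interior_append:
  assumes "ys = [] \<or> hd ys = 1"
  shows "num_interior (xs @ ys) = num_interior xs + num_interior ys"
proof (induction xs rule: induct_list012)
  case (2 x)
  show ?case using assms by (cases ys) (auto simp: num_interior_Cons_Cons)
qed (auto simp: num_interior_Cons_Cons)

lemma num_interior_Cons_1: "num_interior (1 # ws) = num_interior ws"
  by (cases ws) (auto simp: num_interior_Cons_Cons)

text \<open>
  Without positivity the claim fails: truncated subtraction makes a column of height 0 contribute as
  much as one of height 1.
\<close>
lemma num_interior_map_Suc:
  "\<forall>x\<in>set u. 1 \<le> x \<Longrightarrow> num_interior (map Suc u) = num_interior u + (length u - 1)"
  by (induction u rule: induct_list012) (auto simp: num_interior_Cons_Cons min_def)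

section \<open>Decomposition of Motzkin words at the letter 1\<close>
abbreviation motzkin_step :: "nat \<Rightarrow> nat \<Rightarrow> bool" where
  "motzkin_step a b \<equiv> 1 \<le> b \<and> b \<le> a + 1 \<and> a \<noteq> b"

lemma motzkin_word_iff_successively:
  "motzkin_word w \<longleftrightarrow> w \<noteq> [] \<and> hd w = 1 \<and> successively motzkin_step w"
proof -
  have "successively motzkin_step w \<longleftrightarrow> (\<forall>k<length w - 1. motzkin_step (w ! k) (w ! Suc k))"
    by (induction w rule: induct_list012) (simp_all add: All_less_Suc2 del: One_nat_def)
  also have "\<dots> \<longleftrightarrow> (\<forall>k. 1 \<le> k \<and> k < length w \<longrightarrow> motzkin_step (w ! (k - 1)) (w ! k))"
  proof (intro iffI allI impI)
    fix k assume *: "\<forall>k<length w - 1. motzkin_step (w ! k) (w ! Suc k)" and "1 \<le> k \<and> k < length w"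
    moreover from this have "k - 1 < length w - 1" by linarith
    ultimately show "motzkin_step (w ! (k - 1)) (w ! k)" using *[rule_format, of "k - 1"] by simp
  next
    fix k assume *: "\<forall>k. 1 \<le> k \<and> k < length w \<longrightarrow> motzkin_step (w ! (k - 1)) (w ! k)"
      and "k < length w - 1"
    thus "motzkin_step (w ! k) (w ! Suc k)" using *[rule_format, of "Suc k"] by simp
  qed
  finally show ?thesis
    unfolding motzkin_word_def by (cases w) auto
qed

lemma motzkin_word_letters_pos:
  assumes w: "motzkin_word w"
  shows "\<forall>x\<in>set w. 1 \<le> x"
proof
  fix x assume "x \<in> set w"
  then obtain k where k: "k < length w" "x = w ! k" by (metis in_set_conv_nth)
  show "1 \<le> x"
  proof (cases "k = 0")
    case False
    with k w show ?thesis unfolding motzkin_word_def by (metis One_nat_def Suc_leI neq0_conv)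
  qed (use k w in \<open>simp add: motzkin_word_def\<close>)
qed

text \<open>
  The possible second factors \<open>v\<close> of the decomposition: in contrast to \<open>motzkin_words\<close>, the empty word
  is allowed.
\<close>
definition motzkin_tails :: "nat \<Rightarrow> nat list set" where
  "motzkin_tails n = (if n = 0 then {[]} else motzkin_words n)"

lemma motzkin_words_0 [simp]: "motzkin_words 0 = {}"
  by (auto simp: motzkin_words_def motzkin_word_def)

lemma motzkin_words_1: "motzkin_words (Suc 0) = {[1]}"
  by (auto simp: motzkin_words_def motzkin_word_def length_Suc_conv)

lemma motzkin_word_compose:
  assumes u: "motzkin_word u" and v: "v = [] \<or> motzkin_word v"
  shows "motzkin_word (1 # map Suc u @ v)"
proof -
  have u': "u \<noteq> []" "hd u = 1" "successively motzkin_step u"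
    using u unfolding motzkin_word_iff_successively by blast+
  have v': "successively motzkin_step v" "v = [] \<or> hd v = 1"
    using v unfolding motzkin_word_iff_successively by auto
  have "successively motzkin_step (map Suc u)"
    unfolding successively_map by (rule successively_mono[OF u'(3)]) auto
  moreover have "last u \<ge> 1"
    using u'(1) motzkin_word_letters_pos[OF u] by simp
  ultimately have "successively motzkin_step (map Suc u @ v)"
    using u'(1) v' by (auto simp: successively_append_iff last_map)
  moreover have "hd (map Suc u @ v) = 2"
    using u' by (simp add: hd_map)
  ultimately show ?thesis
    unfolding motzkin_word_iff_successively successively_Cons[of _ _ "map Suc u @ v"]
    by (auto simp only: list.sel)
qed

text \<open>
  The letter after the initial 1 must be 2, so the maximal block of letters other than 1 that follows
  is nonempty and starts with 2; lowering it by one unit yields a Motzkin word.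
\<close>
lemma motzkin_word_decompose:
  assumes w: "motzkin_word w" and len: "length w \<ge> 2"
  obtains u v where "w = 1 # map Suc u @ v" "motzkin_word u" "v = [] \<or> motzkin_word v"
proof -
  have w': "w \<noteq> []" "hd w = 1" "successively motzkin_step w"
    using w unfolding motzkin_word_iff_successively by blast+
  define r where "r = tl w"
  have r: "w = 1 # r" "r \<noteq> []"
    using w'(1,2) len unfolding r_def by (cases w; auto)+
  define u' where "u' = takeWhile (\<lambda>x. x \<noteq> 1) r"
  define v where "v = dropWhile (\<lambda>x. x \<noteq> 1) r"
  define u where "u = map (\<lambda>x. x - 1) u'"
  have r_eq: "r = u' @ v" by (simp add: u'_def v_def)
  have pos: "\<forall>x\<in>set r. 1 \<le> x" using motzkin_word_letters_pos[OF w] r by simp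
  have step: "motzkin_step 1 (hd r)" "successively motzkin_step r"
    using w'(3) r(2) unfolding r(1) successively_Cons by blast+
  have hd: "hd r = 2" using step(1) by auto
  hence u'ne: "u' \<noteq> []" using r by (cases r) (auto simp: u'_def)
  have u'2: "\<forall>x\<in>set u'. 2 \<le> x"
  proof
    fix x assume "x \<in> set u'"
    hence "x \<in> set r" "x \<noteq> 1" unfolding u'_def by (auto dest: set_takeWhileD)
    with pos have "1 \<le> x" "x \<noteq> 1" by blast+
    thus "2 \<le> x" by linarith
  qed
  have map_u: "map Suc u = u'"
    unfolding u_def map_map by (rule map_idI) (use u'2 in fastforce)
  have succ: "successively motzkin_step u'" "successively motzkin_step v"
    using step(2) unfolding r_eq by (auto simp: successively_append_iff)
  have "successively motzkin_step (map Suc u)" using succ(1) map_u by simp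
  hence shifted: "successively (\<lambda>a b. motzkin_step (Suc a) (Suc b)) u"
    unfolding successively_map .
  have "\<forall>x\<in>set u. 1 \<le> x" unfolding u_def using u'2 by fastforce
  hence "successively motzkin_step u"
    by (intro successively_mono[OF shifted]) auto
  moreover have "hd u' = 2" using hd u'ne unfolding r_eq by simp
  ultimately have "motzkin_word u"
    using u'ne unfolding motzkin_word_iff_successively u_def by (simp add: hd_map)
  moreover have "v = [] \<or> motzkin_word v"
    using succ(2) hd_dropWhile[of "\<lambda>x. x \<noteq> 1" r]
    unfolding motzkin_word_iff_successively v_def by blast
  ultimately show ?thesis using that[of u v] r r_eq map_u by simp
qed

text \<open>The first factor can be read off from the composed word, which makes the decomposition unique.\<close>
lemma takeWhile_compose:
  assumes u: "motzkin_word u" and v: "v = [] \<or> motzkin_word v"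
  shows "takeWhile (\<lambda>x. x \<noteq> 1) (map Suc u @ v) = map Suc u"
proof -
  have "\<forall>x\<in>set (map Suc u). x \<noteq> 1" using motzkin_word_letters_pos[OF u] by auto
  hence "takeWhile (\<lambda>x. x \<noteq> 1) (map Suc u @ v) = map Suc u @ takeWhile (\<lambda>x. x \<noteq> 1) v"
    by (intro takeWhile_append2) auto
  thus ?thesis using v by (cases v) (auto simp: motzkin_word_iff_successively)
qed

text \<open>
  The index \<open>i = 0\<close> is harmless, as there are no Motzkin words of length 0; with it the sums below
  are literally Cauchy products.
\<close>
lemma bij_betw_motzkin_decomposition:
  assumes n: "n \<ge> 1"
  shows "bij_betw (\<lambda>(i, u, v). 1 # map Suc u @ v)
           (SIGMA i:{0..n}. motzkin_words i \<times> motzkin_tails (n - i)) (motzkin_words (Suc n))"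
  unfolding bij_betw_def
proof
  show "inj_on (\<lambda>(i, u, v). 1 # map Suc u @ v)
          (SIGMA i:{0..n}. motzkin_words i \<times> motzkin_tails (n - i))"
  proof (rule inj_onI, clarsimp)
    fix i u v i' u' v'
    assume *: "u \<in> motzkin_words i" "v \<in> motzkin_tails (n - i)"
      "u' \<in> motzkin_words i'" "v' \<in> motzkin_tails (n - i')"
      and eq: "map Suc u @ v = map Suc u' @ v'"
    from * have "motzkin_word u" "v = [] \<or> motzkin_word v" "motzkin_word u'" "v' = [] \<or> motzkin_word v'"
      by (auto simp: motzkin_words_def motzkin_tails_def split: if_splits)
    with eq have m: "map Suc u = map Suc u'" by (metis takeWhile_compose)
    with eq have "u = u'" "v = v'" by (auto dest: map_injective)
    with * show "i = i' \<and> u = u' \<and> v = v'" by (auto simp: motzkin_words_def)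
  qed
  show "(\<lambda>(i, u, v). 1 # map Suc u @ v) `
          (SIGMA i:{0..n}. motzkin_words i \<times> motzkin_tails (n - i)) = motzkin_words (Suc n)"
  proof (intro equalityI subsetI)
    fix w assume "w \<in> (\<lambda>(i, u, v). 1 # map Suc u @ v) `
          (SIGMA i:{0..n}. motzkin_words i \<times> motzkin_tails (n - i))"
    then obtain i u v where *: "w = 1 # map Suc u @ v" "i \<le> n" "u \<in> motzkin_words i"
        "v \<in> motzkin_tails (n - i)" by auto
    hence "motzkin_word u" "length u = i" "v = [] \<or> motzkin_word v" "length v = n - i"
      by (auto simp: motzkin_words_def motzkin_tails_def split: if_splits)
    with * motzkin_word_compose show "w \<in> motzkin_words (Suc n)"
      by (auto simp: motzkin_words_def)
  next
    fix w assume "w \<in> motzkin_words (Suc n)"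
    hence w: "motzkin_word w" "length w = Suc n" by (auto simp: motzkin_words_def)
    then obtain u v where uv: "w = 1 # map Suc u @ v" "motzkin_word u" "v = [] \<or> motzkin_word v"
      using motzkin_word_decompose[of w] n by auto
    have "length u + length v = n" using w uv by simp
    moreover from this have "v \<in> motzkin_tails (n - length u)"
      using uv by (auto simp: motzkin_tails_def motzkin_words_def)
    ultimately show "w \<in> (\<lambda>(i, u, v). 1 # map Suc u @ v) `
          (SIGMA i:{0..n}. motzkin_words i \<times> motzkin_tails (n - i))"
      using uv by (intro image_eqI[of _ _ "(length u, u, v)"]) (auto simp: motzkin_words_def)
  qed
qed

lemma finite_motzkin_words: "finite (motzkin_words n)"
proof (induction n rule: less_induct)
  case (less n)
  consider "n = 0" | "n = 1" | m where "n = Suc m" "m \<ge> 1"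
    by (cases n) force+
  thus ?case
  proof cases
    case 3
    have "finite (motzkin_words i \<times> motzkin_tails (m - i))" if "i \<in> {0..m}" for i
      using that 3 less by (auto simp: motzkin_tails_def)
    hence "finite (SIGMA i:{0..m}. motzkin_words i \<times> motzkin_tails (m - i))"
      by blast
    thus ?thesis using bij_betw_finite[OF bij_betw_motzkin_decomposition[OF 3(2)]] 3 by simp
  qed (auto simp: motzkin_words_1)
qed

lemma finite_motzkin_tails: "finite (motzkin_tails n)"
  by (auto simp: motzkin_tails_def finite_motzkin_words)

lemma motzkin_words_nonempty:
  assumes "n \<ge> 1" shows "motzkin_words n \<noteq> {}"
proof -
  have "[1..<Suc n] \<in> motzkin_words n"
    using assms by (auto simp: motzkin_words_def motzkin_word_def nth_append)
  thus ?thesis by blast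
qed

lemma sum_motzkin_words_Suc:
  fixes g :: "nat list \<Rightarrow> 'a :: comm_monoid_add"
  assumes n: "n \<ge> 1"
  shows "sum g (motzkin_words (Suc n)) =
           (\<Sum>i=0..n. \<Sum>u\<in>motzkin_words i. \<Sum>v\<in>motzkin_tails (n - i). g (1 # map Suc u @ v))"
proof -
  have "sum g (motzkin_words (Suc n)) =
      (\<Sum>(i, u, v)\<in>(SIGMA i:{0..n}. motzkin_words i \<times> motzkin_tails (n - i)). g (1 # map Suc u @ v))"
    using sum.reindex_bij_betw[OF bij_betw_motzkin_decomposition[OF n], of g]
    by (simp add: case_prod_beta)
  also have "\<dots> = (\<Sum>i=0..n. \<Sum>(u, v)\<in>motzkin_words i \<times> motzkin_tails (n - i). g (1 # map Suc u @ v))"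
    by (subst sum.Sigma) (auto simp: finite_motzkin_words finite_motzkin_tails case_prod_beta)
  finally show ?thesis by (simp add: sum.cartesian_product)
qed

section \<open>Functional equations of the generating functions\<close>
definition count_fps :: "real fps" where
  "count_fps = Abs_fps (\<lambda>n. real (card (motzkin_words n)))"

definition interior_fps :: "real fps" where
  "interior_fps = Abs_fps (\<lambda>n. real (total_interior n))"

lemma count_fps_tails: "(1 + count_fps) $ n = real (card (motzkin_tails n))"
  by (auto simp: count_fps_def motzkin_tails_def)

lemma sum_num_interior_tails:
  "(\<Sum>v\<in>motzkin_tails n. real (num_interior v)) = real (total_interior n)"
  by (auto simp: motzkin_tails_def total_interior_def)

lemma count_fps_eq: "count_fps = fps_X * (1 + count_fps + count_fps ^ 2)"
proof -
  have "count_fps = fps_X + fps_X * (count_fps * (1 + count_fps))"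
  proof (rule fps_ext)
    fix n
    consider "n = 0" | "n = 1" | m where "n = Suc m" "m \<ge> 1"
      by (cases n) force+
    thus "count_fps $ n = (fps_X + fps_X * (count_fps * (1 + count_fps))) $ n"
    proof cases
      case 3
      have "count_fps $ n = (\<Sum>i=0..m. real (card (motzkin_words i)) * real (card (motzkin_tails (m - i))))"
        using sum_motzkin_words_Suc[OF 3(2), of "\<lambda>_. 1 :: real"] 3(1) by (simp add: count_fps_def)
      also have "\<dots> = (count_fps * (1 + count_fps)) $ m"
        unfolding fps_mult_nth count_fps_tails by (simp add: count_fps_def)
      finally show ?thesis using 3 by simp
    qed (auto simp: count_fps_def motzkin_words_1)
  qed
  also have "\<dots> = fps_X * (1 + count_fps + count_fps ^ 2)"
    by (simp add: algebra_simps power2_eq_square)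
  finally show ?thesis .
qed

text \<open>
  The series \<open>x M' - M\<close> has the coefficients \<open>(i - 1) m\<^sub>i\<close>, the number of interior points gained by
  raising all words of length \<open>i\<close> by one unit.
\<close>
lemma interior_fps_eq:
  "interior_fps = fps_X * ((interior_fps + (fps_X * fps_deriv count_fps - count_fps)) * (1 + count_fps)
     + count_fps * interior_fps)"
proof (rule fps_ext)
  fix n
  define lift where "lift = fps_X * fps_deriv count_fps - count_fps"
  have lift: "lift $ i = real (card (motzkin_words i)) * real (i - 1)" for i
    by (cases i) (auto simp: lift_def count_fps_def algebra_simps)
  have IC: "interior_fps $ i = real (total_interior i)" "count_fps $ i = real (card (motzkin_words i))" for i
    by (auto simp: interior_fps_def count_fps_def)
  have t01: "total_interior 0 = 0" "total_interior (Suc 0) = 0"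
    by (auto simp: total_interior_def motzkin_words_1)
  consider "n = 0" | "n = 1" | m where "n = Suc m" "m \<ge> 1"
    by (cases n) force+
  thus "interior_fps $ n = (fps_X * ((interior_fps + (fps_X * fps_deriv count_fps - count_fps)) * (1 + count_fps)
     + count_fps * interior_fps)) $ n"
  proof cases
    case 3
    have "interior_fps $ n = (\<Sum>w\<in>motzkin_words (Suc m). real (num_interior w))"
      by (simp add: IC 3 total_interior_def)
    also have "\<dots> = (\<Sum>i=0..m. \<Sum>u\<in>motzkin_words i. \<Sum>v\<in>motzkin_tails (m - i).
        real (num_interior (1 # map Suc u @ v)))"
      by (rule sum_motzkin_words_Suc[OF 3(2)])
    also have "\<dots> = (\<Sum>i=0..m. \<Sum>u\<in>motzkin_words i. \<Sum>v\<in>motzkin_tails (m - i).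
        (real (num_interior u) + real (i - 1)) + real (num_interior v))"
    proof (intro sum.cong refl)
      fix i u v assume "u \<in> motzkin_words i" "v \<in> motzkin_tails (m - i)"
      hence "motzkin_word u" and len: "length u = i" and "v = [] \<or> motzkin_word v"
        by (auto simp: motzkin_words_def motzkin_tails_def split: if_splits)
      hence "\<forall>x\<in>set u. 1 \<le> x" "v = [] \<or> hd v = 1"
        using motzkin_word_letters_pos motzkin_word_iff_successively by blast+
      thus "real (num_interior (1 # map Suc u @ v)) = (real (num_interior u) + real (i - 1)) + real (num_interior v)"
        unfolding num_interior_Cons_1 by (simp add: num_interior_append num_interior_map_Suc len)
    qed
    also have "\<dots> = (\<Sum>i=0..m. (real (total_interior i) + real (card (motzkin_words i)) * real (i - 1))
          * real (card (motzkin_tails (m - i)))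
        + real (card (motzkin_words i)) * real (total_interior (m - i)))"
    proof (rule sum.cong)
      fix i
      have "(\<Sum>u\<in>motzkin_words i. \<Sum>v\<in>motzkin_tails (m - i).
              (real (num_interior u) + real (i - 1)) + real (num_interior v)) =
            (\<Sum>u\<in>motzkin_words i. (real (num_interior u) + real (i - 1)) * real (card (motzkin_tails (m - i)))
              + real (total_interior (m - i)))"
        unfolding sum.distrib[of _ _ "motzkin_tails (m - i)"] sum_num_interior_tails
        by (simp add: algebra_simps)
      also have "\<dots> = (real (total_interior i) + real (card (motzkin_words i)) * real (i - 1))
          * real (card (motzkin_tails (m - i))) + real (card (motzkin_words i)) * real (total_interior (m - i))"
        by (simp add: sum.distrib total_interior_def flip: sum_distrib_right)
      finally show "(\<Sum>u\<in>motzkin_words i. \<Sum>v\<in>motzkin_tails (m - i).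
              (real (num_interior u) + real (i - 1)) + real (num_interior v)) =
          (real (total_interior i) + real (card (motzkin_words i)) * real (i - 1))
          * real (card (motzkin_tails (m - i))) + real (card (motzkin_words i)) * real (total_interior (m - i))" .
    qed simp
    also have "\<dots> = (((interior_fps + lift) * (1 + count_fps)) + count_fps * interior_fps) $ m"
      by (simp only: fps_add_nth[of _ "count_fps * interior_fps"] fps_mult_nth count_fps_tails
           fps_add_nth[of interior_fps] lift IC sum.distrib)
    finally show ?thesis using 3 by (simp add: lift_def)
  qed (auto simp: IC t01)
qed

section \<open>Coefficients of powers of the quadratic polynomial\<close>

text \<open>
  If \<open>\<alpha> n\<close> behaves like \<open>L n\<^sup>-\<^sup>p\<close> and \<open>\<beta>\<close> decays fast enough, then each term \<open>\<beta> k \<alpha> (n - k)\<close>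
  contributes \<open>\<beta> k L n\<^sup>-\<^sup>p\<close> in the limit.  Limit and sum may be exchanged by Tannery's theorem,
  because \<open>n \<le> (k + 1) (n - k)\<close> for \<open>k < n\<close> bounds the rescaled terms by a multiple of
  \<open>(k + 1)\<^sup>p \<bar>\<beta> k\<bar>\<close>, uniformly in \<open>n\<close>.
\<close>
lemma convolution_powr_asymptotics:
  fixes \<alpha> \<beta> :: "nat \<Rightarrow> real"
  assumes p: "p \<ge> 0"
    and lim: "(\<lambda>n. real n powr p * \<alpha> n) \<longlonglongrightarrow> L"
    and summ: "summable (\<lambda>k. real (Suc k) powr p * \<bar>\<beta> k\<bar>)"
  shows "(\<lambda>n. real n powr p * (\<Sum>k=0..n. \<beta> k * \<alpha> (n - k))) \<longlonglongrightarrow> (\<Sum>k. \<beta> k * L)"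
proof -
  define a where "a k n = (if k \<le> n then real n powr p * (\<beta> k * \<alpha> (n - k)) else 0)" for k n
  obtain C where C: "\<And>n. \<bar>real n powr p * \<alpha> n\<bar> \<le> C"
    using convergent_imp_Bseq[OF convergentI[OF lim]] unfolding Bseq_def by auto
  have C0: "C \<ge> 0" using C[of 0] by linarith
  have bound: "\<bar>a k n\<bar> \<le> (C + \<bar>\<alpha> 0\<bar>) * (real (Suc k) powr p * \<bar>\<beta> k\<bar>)" for k n
  proof (cases "k \<le> n")
    case True
    have "real n powr p * \<bar>\<alpha> (n - k)\<bar> \<le> (C + \<bar>\<alpha> 0\<bar>) * real (Suc k) powr p"
    proof (cases "n = k")
      case True
      have "real n powr p * \<bar>\<alpha> (n - k)\<bar> \<le> real (Suc k) powr p * \<bar>\<alpha> 0\<bar>"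
        using True p by (intro mult_mono powr_mono2) auto
      also have "\<dots> \<le> (C + \<bar>\<alpha> 0\<bar>) * real (Suc k) powr p"
        using C0 by (simp add: algebra_simps)
      finally show ?thesis .
    next
      case False
      define m where "m = n - k"
      have m: "m \<ge> 1" "n = m + k" using False True by (auto simp: m_def)
      have "n \<le> Suc k * m" using m by (cases m) auto
      hence "real n \<le> real (Suc k) * real m" by (metis of_nat_le_iff of_nat_mult)
      hence "real n powr p \<le> (real (Suc k) * real m) powr p"
        using p by (intro powr_mono2) auto
      hence "real n powr p * \<bar>\<alpha> m\<bar> \<le> (real (Suc k) powr p * real m powr p) * \<bar>\<alpha> m\<bar>"
        by (intro mult_right_mono) (auto simp: powr_mult)
      also have "\<dots> = real (Suc k) powr p * \<bar>real m powr p * \<alpha> m\<bar>"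
        by (simp add: abs_mult)
      also have "\<dots> \<le> real (Suc k) powr p * (C + \<bar>\<alpha> 0\<bar>)"
        using C[of m] by (intro mult_left_mono) auto
      finally show ?thesis by (simp add: m_def mult.commute)
    qed
    hence "real n powr p * \<bar>\<alpha> (n - k)\<bar> * \<bar>\<beta> k\<bar> \<le> (C + \<bar>\<alpha> 0\<bar>) * real (Suc k) powr p * \<bar>\<beta> k\<bar>"
      by (rule mult_right_mono) simp
    thus ?thesis using True by (simp add: a_def abs_mult mult_ac)
  qed (use C0 in \<open>auto simp: a_def\<close>)
  have term_lim: "(\<lambda>n. a k n) \<longlonglongrightarrow> \<beta> k * L" for k
  proof (rule LIMSEQ_offset[of _ k])
    have ratio: "(\<lambda>n. (real (n + k) / real n) powr p) \<longlonglongrightarrow> 1 powr p"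
      by (intro tendsto_powr tendsto_const) (real_asymp, simp)
    have "(\<lambda>n. \<beta> k * ((real (n + k) / real n) powr p * (real n powr p * \<alpha> n))) \<longlonglongrightarrow> \<beta> k * (1 powr p * L)"
      by (intro tendsto_intros ratio lim)
    moreover have "eventually (\<lambda>n. \<beta> k * ((real (n + k) / real n) powr p * (real n powr p * \<alpha> n)) = a k (n + k)) sequentially"
      using eventually_gt_at_top[of 0]
      by eventually_elim (simp add: a_def powr_divide)
    ultimately show "(\<lambda>n. a k (n + k)) \<longlonglongrightarrow> \<beta> k * L"
      using Lim_transform_eventually by fastforce
  qed
  have "(\<lambda>n. suminf (\<lambda>k. a k n)) \<longlonglongrightarrow> (\<Sum>k. \<beta> k * L)"
    using tannerys_theorem[of a "\<lambda>k. \<beta> k * L" sequentially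
        "\<lambda>k. (C + \<bar>\<alpha> 0\<bar>) * (real (Suc k) powr p * \<bar>\<beta> k\<bar>)"]
      term_lim bound summable_mult[OF summ] by (auto intro!: always_eventually)
  moreover have "suminf (\<lambda>k. a k n) = real n powr p * (\<Sum>k=0..n. \<beta> k * \<alpha> (n - k))" for n
  proof -
    have "suminf (\<lambda>k. a k n) = (\<Sum>k=0..n. a k n)"
      by (rule suminf_finite) (auto simp: a_def)
    thus ?thesis by (simp add: a_def sum_distrib_left)
  qed
  ultimately show ?thesis by simp
qed

lemma abs_gbinomial_le_1:
  fixes a :: real
  assumes "\<bar>a\<bar> \<le> 1"
  shows "\<bar>a gchoose k\<bar> \<le> 1"
proof (induction k)
  case (Suc k)
  have "real (Suc k) * \<bar>a gchoose Suc k\<bar> = \<bar>a - real k\<bar> * \<bar>a gchoose k\<bar>"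
    by (metis gbinomial_absorb_comp gbinomial_absorption abs_mult abs_of_nat)
  also have "\<dots> \<le> real (Suc k) * 1"
    using assms Suc by (intro mult_mono) auto
  finally show ?case by (simp del: of_nat_Suc)
qed auto

text \<open>
  The power \<open>((1 + x) (1 - 3 x))\<^sup>a\<close>, with one binomial series for each factor.
\<close>
definition quadratic_power :: "real \<Rightarrow> real fps" where
  "quadratic_power a = fps_binomial a * (fps_binomial a oo (fps_const (-3) * fps_X))"

lemma quadratic_power_add: "quadratic_power (a + b) = quadratic_power a * quadratic_power b"
  by (simp add: quadratic_power_def fps_binomial_add_mult fps_compose_mult_distrib mult_ac)

lemma quadratic_power_0: "quadratic_power 0 = 1"
  by (simp add: quadratic_power_def)

lemma quadratic_power_1: "quadratic_power 1 = 1 - 2 * fps_X - 3 * fps_X ^ 2"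
proof -
  have "quadratic_power 1 = (1 + fps_X) * (1 + fps_const (-3) * fps_X)"
    by (simp add: quadratic_power_def fps_binomial_1 fps_compose_add_distrib)
  also have "fps_const (-3) = (-3 :: real fps)"
    by (simp add: numeral_fps_const fps_const_neg[symmetric] del: fps_const_neg)
  finally show ?thesis by (simp add: algebra_simps power2_eq_square)
qed

lemma quadratic_power_nth_0 [simp]: "quadratic_power a $ 0 = 1"
  by (simp add: quadratic_power_def)

text \<open>
  After division by \<open>3\<^sup>n\<close>, the coefficients are the convolution of those of \<open>(1 - y)\<^sup>a\<close>, which
  are asymptotic to \<open>n\<^sup>-\<^sup>a\<^sup>-\<^sup>1 / Gamma (- a)\<close>, with the geometrically decaying ones of \<open>(1 + y / 3)\<^sup>a\<close>,
  whose sum is \<open>(4 / 3)\<^sup>a\<close>.  The bound \<open>-1 \<le> a\<close> makes the exponent \<open>a + 1\<close> nonnegative, and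
  \<open>\<bar>a\<bar> \<le> 1\<close> keeps all binomial coefficients within \<open>[-1, 1]\<close>.
\<close>
lemma quadratic_power_asymptotics:
  assumes a: "-1 \<le> a" "a \<le> 1"
  shows "(\<lambda>n. real n powr (a + 1) * (quadratic_power a $ n / 3 ^ n))
           \<longlonglongrightarrow> (4 / 3) powr a / Gamma (- a)"
proof -
  define \<alpha> where "\<alpha> n = (-1) ^ n * (a gchoose n)" for n
  define \<beta> where "\<beta> k = (a gchoose k) * (1 / 3) ^ k" for k
  have coeff: "quadratic_power a $ n / 3 ^ n = (\<Sum>k=0..n. \<beta> k * \<alpha> (n - k))" for n
  proof -
    have "quadratic_power a $ n = (\<Sum>k=0..n. (a gchoose k) * ((-3) ^ (n - k) * (a gchoose (n - k))))"
      by (simp add: quadratic_power_def fps_mult_nth fps_compose_linear)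
    also have "\<dots> / 3 ^ n = (\<Sum>k=0..n. \<beta> k * \<alpha> (n - k))"
      unfolding sum_divide_distrib
    proof (rule sum.cong)
      fix k assume "k \<in> {0..n}"
      hence "(3::real) ^ n = 3 ^ k * 3 ^ (n - k)" by (simp flip: power_add)
      moreover have "(-3 :: real) ^ (n - k) = (-1) ^ (n - k) * 3 ^ (n - k)"
        by (simp flip: power_mult_distrib)
      ultimately show "(a gchoose k) * ((-3) ^ (n - k) * (a gchoose (n - k))) / 3 ^ n = \<beta> k * \<alpha> (n - k)"
        by (simp add: \<alpha>_def \<beta>_def power_divide)
    qed simp
    finally show ?thesis .
  qed
  have lim: "(\<lambda>n. real n powr (a + 1) * \<alpha> n) \<longlonglongrightarrow> inverse (Gamma (- a))"
  proof (rule Lim_transform_eventually[OF gbinomial_asymptotic[of a]])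
    show "eventually (\<lambda>n. (a gchoose n) / ((-1) ^ n / exp ((a + 1) * of_real (ln (real n)))) =
        real n powr (a + 1) * \<alpha> n) sequentially"
      using eventually_gt_at_top[of 0]
      by eventually_elim (auto simp: \<alpha>_def powr_def minus_one_power_iff)
  qed
  have summ: "summable (\<lambda>k. real (Suc k) powr (a + 1) * \<bar>\<beta> k\<bar>)"
  proof (rule summable_comparison_test_ev)
    have "eventually (\<lambda>k. real (Suc k) ^ 2 * (1 / 3) ^ k \<le> (1 / 2) ^ k) sequentially"
      by real_asymp
    thus "eventually (\<lambda>k. norm (real (Suc k) powr (a + 1) * \<bar>\<beta> k\<bar>) \<le> (1 / 2) ^ k) sequentially"
    proof eventually_elim
      case (elim k)
      have "real (Suc k) powr (a + 1) \<le> real (Suc k) powr 2"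
        using a by (intro powr_mono) auto
      hence "real (Suc k) powr (a + 1) \<le> real (Suc k) ^ 2" by simp
      moreover have "\<bar>\<beta> k\<bar> \<le> (1 / 3) ^ k"
        using abs_gbinomial_le_1[of a k] a by (simp add: \<beta>_def abs_mult mult_le_cancel_right1)
      ultimately have "real (Suc k) powr (a + 1) * \<bar>\<beta> k\<bar> \<le> real (Suc k) ^ 2 * (1 / 3) ^ k"
        by (intro mult_mono) auto
      with elim show ?case by simp
    qed
    show "summable (\<lambda>k. (1 / 2 :: real) ^ k)" by (rule summable_geometric) simp
  qed
  have "\<beta> sums (1 + 1 / 3) powr a"
    unfolding \<beta>_def by (rule gen_binomial_real) simp
  hence "(\<Sum>k. \<beta> k * inverse (Gamma (- a))) = (4 / 3) powr a / Gamma (- a)"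
    using sums_unique[OF sums_mult2[of \<beta> _ "inverse (Gamma (- a))"]] by (simp add: field_simps)
  with convolution_powr_asymptotics[OF _ lim summ] a show ?thesis
    by (simp add: coeff)
qed

section \<open>The closed form of the generating function\<close>

text \<open>
  Solving the quadratic equation for \<open>M\<close> gives \<open>2 x M = 1 - x - S\<close> with \<open>S\<close> a square root of the
  discriminant.  Taking this as the definition of \<open>S\<close> avoids the choice of a branch: the constant
  coefficient 1 identifies \<open>S\<close> with any other description of the root.
\<close>
definition motzkin_root :: "real fps" where
  "motzkin_root = 1 - fps_X - 2 * fps_X * count_fps"

lemma motzkin_root_square: "motzkin_root ^ 2 = 1 - 2 * fps_X - 3 * fps_X ^ 2"
proof -
  have "fps_X * count_fps ^ 2 = count_fps - fps_X - fps_X * count_fps"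
    using count_fps_eq by algebra
  thus ?thesis unfolding motzkin_root_def by algebra
qed

lemma motzkin_root_nth_0: "motzkin_root $ 0 = 1"
  by (simp add: motzkin_root_def)

lemma square_root_unique:
  fixes A B :: "real fps"
  assumes "A ^ 2 = B ^ 2" "A $ 0 = 1" "B $ 0 = 1"
  shows "A = B"
proof -
  have "(A - B) * (A + B) = 0" using assms(1) by (simp add: algebra_simps power2_eq_square)
  moreover have "A + B \<noteq> 0" using assms(2,3) by (auto dest!: arg_cong[of _ _ "\<lambda>F. F $ 0"])
  ultimately show ?thesis by simp
qed

lemma motzkin_root_eq_radical:
  "motzkin_root = fps_radical root 2 (1 - 2 * fps_X - 3 * fps_X ^ 2)"
  using radical_unique[of root 1 "1 - 2 * fps_X - 3 * fps_X ^ 2" motzkin_root]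
    motzkin_root_square motzkin_root_nth_0
  by (simp add: numeral_2_eq_2)

lemma motzkin_root_eq_quadratic_power: "motzkin_root = quadratic_power (1 / 2)"
  by (rule square_root_unique)
     (simp_all add: motzkin_root_nth_0 motzkin_root_square power2_eq_square[of "quadratic_power _"]
        quadratic_power_1 flip: quadratic_power_add)

lemma interior_fps_times_denominator:
  "interior_fps * (2 * fps_X * (1 + fps_X) * (1 - 3 * fps_X)) =
     2 - 3 * fps_X - 5 * fps_X ^ 2 - (2 - fps_X - 2 * fps_X ^ 2) * motzkin_root"
proof -
  have M: "count_fps = fps_X * (1 + count_fps + count_fps ^ 2)" by (rule count_fps_eq)
  have "fps_deriv count_fps = fps_deriv (fps_X * (1 + count_fps + count_fps ^ 2))"
    using M by (rule arg_cong)
  \<comment> \<open>Solving this for the derivative: \<open>M' S = 1 + M + M\<^sup>2\<close>.\<close>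
  hence deriv: "fps_deriv count_fps = (1 + count_fps + count_fps ^ 2) +
      fps_X * (fps_deriv count_fps + 2 * count_fps * fps_deriv count_fps)"
    by (simp add: power2_eq_square algebra_simps)
  have lift: "fps_X * fps_deriv count_fps * motzkin_root = count_fps"
    using M deriv unfolding motzkin_root_def by algebra
  have "interior_fps * motzkin_root = fps_X * (fps_X * fps_deriv count_fps - count_fps) * (1 + count_fps)"
    using interior_fps_eq unfolding motzkin_root_def by algebra
  hence "interior_fps * motzkin_root ^ 2 = fps_X * (count_fps - count_fps * motzkin_root) * (1 + count_fps)"
    using lift by algebra
  hence "interior_fps * motzkin_root ^ 2 = (count_fps - fps_X) * (1 - motzkin_root)"
    using M by algebra
  moreover have "2 * fps_X * (count_fps - fps_X) = 1 - fps_X - motzkin_root - 2 * fps_X ^ 2"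
    unfolding motzkin_root_def by algebra
  ultimately show ?thesis using motzkin_root_square by algebra
qed

lemma interior_fps_closed_form:
  "interior_fps =
     (2 - 3 * fps_X - 5 * fps_X ^ 2 - (2 - fps_X - 2 * fps_X ^ 2) * motzkin_root)
       / (2 * fps_X * (1 + fps_X) * (1 - 3 * fps_X))"
proof -
  have "(1 + fps_X :: real fps) \<noteq> 0" "(1 - 3 * fps_X :: real fps) \<noteq> 0"
    by (auto dest!: arg_cong[of _ _ "\<lambda>F. F $ 0"])
  hence "2 * fps_X * (1 + fps_X) * (1 - 3 * fps_X) \<noteq> (0 :: real fps)"
    by simp
  thus ?thesis
    unfolding interior_fps_times_denominator[symmetric] by simp
qed

section \<open>Asymptotics\<close>
lemma geometric_fps_inverse: "Abs_fps (\<lambda>n. c ^ n) * (1 - fps_const c * fps_X) = (1 :: real fps)"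
proof (rule fps_ext)
  fix n
  have "Abs_fps (\<lambda>n. c ^ n) * (1 - fps_const c * fps_X) =
      Abs_fps (\<lambda>n. c ^ n) - fps_const c * (fps_X * Abs_fps (\<lambda>n. c ^ n))"
    by (simp add: algebra_simps)
  thus "(Abs_fps (\<lambda>n. c ^ n) * (1 - fps_const c * fps_X)) $ n = (1 :: real fps) $ n"
    by (cases n) auto
qed

text \<open>
  This splits off the simple pole at \<open>x = 1 / 3\<close>, which carries the main term, from the algebraic
  singularity of \<open>1 / S\<close>.  It results from \<open>2 - 3 x - 5 x\<^sup>2 = (1 + x) (2 - 5 x)\<close> and
  \<open>S / ((1 + x) (1 - 3 x)) = 1 / S\<close>.
\<close>
lemma interior_fps_partial_fractions:
  "2 * fps_X * interior_fps =
     (2 - 5 * fps_X) * Abs_fps (\<lambda>n. 3 ^ n)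
       - (2 - fps_X - 2 * fps_X ^ 2) * quadratic_power (- 1 / 2)"
proof -
  define T where "T = quadratic_power (- 1 / 2)"
  define G where "G = Abs_fps (\<lambda>n. 3 ^ n :: real)"
  have T: "motzkin_root * T = 1"
    unfolding T_def motzkin_root_eq_quadratic_power
    by (simp add: quadratic_power_0 flip: quadratic_power_add)
  have G: "G * (1 - 3 * fps_X) = 1"
    using geometric_fps_inverse[of 3] by (simp add: G_def numeral_fps_const)
  have nz: "(1 + fps_X :: real fps) \<noteq> 0" 
    by (auto dest!: arg_cong[of _ _ "\<lambda>F. F $ 0"])
  have DG: "motzkin_root * G = (1 + fps_X) * T"
    using T G motzkin_root_square by algebra
  have "(1 + fps_X) * (2 * fps_X * interior_fps) =
      (2 - 3 * fps_X - 5 * fps_X ^ 2 - (2 - fps_X - 2 * fps_X ^ 2) * motzkin_root) * G"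
    using interior_fps_times_denominator G by algebra
  also have "\<dots> = (1 + fps_X) * ((2 - 5 * fps_X) * G - (2 - fps_X - 2 * fps_X ^ 2) * T)"
    using DG by algebra
  finally have "2 * fps_X * interior_fps = (2 - 5 * fps_X) * G - (2 - fps_X - 2 * fps_X ^ 2) * T"
    using nz mult_left_cancel by blast
  thus ?thesis by (simp only: T_def G_def)
qed

text \<open>
  The coefficient of \<open>x\<^sup>n\<^sup>+\<^sup>1\<close> in \<open>(2 - 5 x) / (1 - 3 x)\<close> is \<open>2 \<cdot> 3\<^sup>n\<^sup>+\<^sup>1 - 5 \<cdot> 3\<^sup>n = 3\<^sup>n\<close>, so the main
  term is exact.
\<close>
lemma total_interior_conv_quadratic_power:
  defines "T \<equiv> fps_nth (quadratic_power (- 1 / 2))"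
  shows "2 * real (total_interior (Suc n)) =
           3 ^ Suc n - (2 * T (Suc (Suc n)) - T (Suc n) - 2 * T n)"
proof -
  have "(2 * fps_X * interior_fps) $ Suc (Suc n) = 2 * real (total_interior (Suc n))"
    by (simp add: mult.assoc interior_fps_def fps_numeral_fps_const)
  moreover have "((2 - 5 * fps_X) * Abs_fps (\<lambda>n. 3 ^ n :: real)) $ Suc (Suc n) = 3 ^ Suc n"
    by (simp add: left_diff_distrib mult.assoc)
  moreover have "((2 - fps_X - 2 * fps_X ^ 2) * quadratic_power (- 1 / 2)) $ Suc (Suc n) =
      2 * T (Suc (Suc n)) - T (Suc n) - 2 * T n"
    by (simp add: left_diff_distrib mult.assoc power2_eq_square T_def)
  ultimately show ?thesis
    using arg_cong[OF interior_fps_partial_fractions, of "\<lambda>F. F $ Suc (Suc n)"] by simp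
qed

text \<open>The central trinomial coefficients, i.e. those of \<open>1 / S\<close>, are \<open>o(3\<^sup>n)\<close>.\<close>
lemma total_interior_limit: "(\<lambda>n. real (total_interior n) / 3 ^ n) \<longlonglongrightarrow> 1 / 2"
proof -
  define t where "t n = quadratic_power (- 1 / 2) $ n / 3 ^ n" for n
  have "(\<lambda>n. real n powr (1 / 2) * t n) \<longlonglongrightarrow> (4 / 3) powr (- 1 / 2) / Gamma (1 / 2)"
    using quadratic_power_asymptotics[of "- 1 / 2"] by (simp add: t_def)
  moreover have "(\<lambda>n. real n powr (- 1 / 2)) \<longlonglongrightarrow> 0" by real_asymp
  ultimately have "(\<lambda>n. real n powr (- 1 / 2) * (real n powr (1 / 2) * t n)) \<longlonglongrightarrow> 0 * ((4 / 3) powr (- 1 / 2) / Gamma (1 / 2))"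
    by (intro tendsto_mult)
  moreover have "eventually (\<lambda>n. real n powr (- 1 / 2) * (real n powr (1 / 2) * t n) = t n) sequentially"
    using eventually_gt_at_top[of 0]
    by eventually_elim (simp add: mult.assoc[symmetric] powr_add[symmetric])
  ultimately have t: "t \<longlonglongrightarrow> 0"
    using Lim_transform_eventually by fastforce
  have "(\<lambda>n. 1 / 2 - (2 * (3 * t (Suc (Suc n))) - t (Suc n) - 2 * (t n / 3)) / 2) \<longlonglongrightarrow> 1 / 2 - (2 * (3 * 0) - 0 - 2 * (0 / 3)) / 2"
    by (intro tendsto_intros t LIMSEQ_Suc[OF t] LIMSEQ_Suc[OF LIMSEQ_Suc[OF t]]) simp_all
  moreover have "1 / 2 - (2 * (3 * t (Suc (Suc n))) - t (Suc n) - 2 * (t n / 3)) / 2 =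
      real (total_interior (Suc n)) / 3 ^ Suc n" for n
  proof -
    have "real (total_interior (Suc n)) = (3 ^ Suc n - (2 * (3 ^ Suc (Suc n) * t (Suc (Suc n)))
            - 3 ^ Suc n * t (Suc n) - 2 * (3 ^ n * t n))) / 2"
      using total_interior_conv_quadratic_power[of n] by (simp add: t_def)
    thus ?thesis by (simp add: field_simps)
  qed
  ultimately have "(\<lambda>n. real (total_interior (Suc n)) / 3 ^ Suc n) \<longlonglongrightarrow> 1 / 2"
    by (simp only: mult_zero_right div_0 diff_zero)
  thus ?thesis by (rule LIMSEQ_imp_Suc)
qed

lemma Gamma_minus_one_half: "Gamma (- (1 / 2) :: real) = - (2 * sqrt pi)"
proof -
  have "- (1 / 2 :: real) \<notin> \<int>\<^sub>\<le>\<^sub>0"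
    using fraction_not_in_Ints[of 2 "- 1", where 'a = real] nonpos_Ints_Int by auto
  thus ?thesis
    using Gamma_plus1[of "- (1 / 2) :: real"] Gamma_one_half_real by simp
qed

text \<open>
  Beyond the linear terms, \<open>S = 1 - x - 2 x M\<close> shows that the number of words of length \<open>n\<close> is
  \<open>- 1 / 2\<close> times the coefficient of \<open>x\<^sup>n\<^sup>+\<^sup>1\<close> in \<open>S\<close>.  The factor \<open>- 3 / 2\<close> in the proof combines this
  with the index shift in \<open>3\<^sup>n\<^sup>+\<^sup>1\<close>.
\<close>
lemma card_motzkin_words_limit:
  "(\<lambda>n. real n powr (3 / 2) * (real (card (motzkin_words n)) / 3 ^ n)) \<longlonglongrightarrow> sqrt (3 / (4 * pi))"
proof -
  define s where "s n = real n powr (3 / 2) * (motzkin_root $ n / 3 ^ n)" for n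
  have s: "s \<longlonglongrightarrow> (4 / 3) powr (1 / 2) / Gamma (- (1 / 2))"
    using quadratic_power_asymptotics[of "1 / 2"]
    by (simp add: s_def[abs_def] motzkin_root_eq_quadratic_power)
  have ratio: "(\<lambda>n. (real n / real (Suc n)) powr (3 / 2)) \<longlonglongrightarrow> 1" by real_asymp
  have "(\<lambda>n. (- 3 / 2) * ((real n / real (Suc n)) powr (3 / 2) * s (Suc n)))
      \<longlonglongrightarrow> (- 3 / 2) * (1 * ((4 / 3) powr (1 / 2) / Gamma (- (1 / 2))))"
    by (intro tendsto_mult tendsto_const ratio LIMSEQ_Suc[OF s])
  moreover have "eventually (\<lambda>n. (- 3 / 2) * ((real n / real (Suc n)) powr (3 / 2) * s (Suc n)) =
      real n powr (3 / 2) * (real (card (motzkin_words n)) / 3 ^ n)) sequentially"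
    using eventually_gt_at_top[of 0]
  proof eventually_elim
    case (elim n)
    have "motzkin_root $ Suc n = - 2 * real (card (motzkin_words n))"
      using elim by (simp add: motzkin_root_def mult.assoc count_fps_def)
    thus ?case
      by (simp add: s_def powr_divide field_simps)
  qed
  moreover have "(- 3 / 2) * (1 * ((4 / 3) powr (1 / 2) / Gamma (- (1 / 2)))) = sqrt (3 / (4 * pi))"
    by (simp add: Gamma_minus_one_half powr_half_sqrt real_sqrt_divide real_sqrt_mult field_simps)
  ultimately show ?thesis
    using Lim_transform_eventually by fastforce
qed

theorem corollary6p3:
  shows "Abs_fps (\<lambda>n. if n \<ge> 1 then real (total_interior n) else 0) =
           (2 - 3 * fps_X - 5 * fps_X ^ 2
              - (2 - fps_X - 2 * fps_X ^ 2) * fps_radical root 2 (1 - 2 * fps_X - 3 * fps_X ^ 2))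
           / (2 * fps_X * (1 + fps_X) * (1 - 3 * fps_X))
       \<and> (\<lambda>n. real (total_interior n)) \<sim>[at_top] (\<lambda>n. 3 ^ n / 2)
       \<and> (\<forall>n\<ge>1. measure_pmf.expectation (pmf_of_set (motzkin_words n)) (\<lambda>w. real (num_interior w))
             = real (total_interior n) / real (card (motzkin_words n)))
       \<and> (\<lambda>n. measure_pmf.expectation (pmf_of_set (motzkin_words n)) (\<lambda>w. real (num_interior w)))
             \<sim>[at_top] (\<lambda>n. sqrt (pi / 3) * real n powr (3 / 2))"
proof (intro conjI)
  have "Abs_fps (\<lambda>n. if n \<ge> 1 then real (total_interior n) else 0) = interior_fps"
    by (rule fps_ext) (auto simp: interior_fps_def total_interior_def not_less_eq_eq)
  thus "Abs_fps (\<lambda>n. if n \<ge> 1 then real (total_interior n) else 0) =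
           (2 - 3 * fps_X - 5 * fps_X ^ 2
              - (2 - fps_X - 2 * fps_X ^ 2) * fps_radical root 2 (1 - 2 * fps_X - 3 * fps_X ^ 2))
           / (2 * fps_X * (1 + fps_X) * (1 - 3 * fps_X))"
    unfolding motzkin_root_eq_radical[symmetric] using interior_fps_closed_form by metis
  have "(\<lambda>n. 2 * (real (total_interior n) / 3 ^ n)) \<longlonglongrightarrow> 2 * (1 / 2)"
    by (intro tendsto_intros total_interior_limit)
  thus "(\<lambda>n. real (total_interior n)) \<sim>[at_top] (\<lambda>n. 3 ^ n / 2)"
    by (intro asymp_equivI') (simp add: mult.commute)
  show expect: "\<forall>n\<ge>1. measure_pmf.expectation (pmf_of_set (motzkin_words n)) (\<lambda>w. real (num_interior w))
             = real (total_interior n) / real (card (motzkin_words n))"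
    by (auto simp: integral_pmf_of_set motzkin_words_nonempty finite_motzkin_words total_interior_def)
  have "(\<lambda>n. (real (total_interior n) / 3 ^ n) /
           ((real n powr (3 / 2) * (real (card (motzkin_words n)) / 3 ^ n)) * sqrt (pi / 3)))
        \<longlonglongrightarrow> (1 / 2) / (sqrt (3 / (4 * pi)) * sqrt (pi / 3))"
    by (intro tendsto_intros total_interior_limit card_motzkin_words_limit) auto
  also have "(1 / 2) / (sqrt (3 / (4 * pi)) * sqrt (pi / 3)) = 1"
    by (simp add: real_sqrt_divide real_sqrt_mult)
  finally have "(\<lambda>n. (real (total_interior n) / 3 ^ n) /
           ((real n powr (3 / 2) * (real (card (motzkin_words n)) / 3 ^ n)) * sqrt (pi / 3)))
        \<longlonglongrightarrow> 1" .
  moreover have "eventually (\<lambda>n. (real (total_interior n) / 3 ^ n) /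
           ((real n powr (3 / 2) * (real (card (motzkin_words n)) / 3 ^ n)) * sqrt (pi / 3)) =
      measure_pmf.expectation (pmf_of_set (motzkin_words n)) (\<lambda>w. real (num_interior w)) /
        (sqrt (pi / 3) * real n powr (3 / 2))) sequentially"
    using eventually_ge_at_top[of 1]
  proof eventually_elim
    case (elim n)
    thus ?case using expect by (simp add: mult_ac)
  qed
  ultimately show "(\<lambda>n. measure_pmf.expectation (pmf_of_set (motzkin_words n)) (\<lambda>w. real (num_interior w)))
             \<sim>[at_top] (\<lambda>n. sqrt (pi / 3) * real n powr (3 / 2))"
    by (intro asymp_equivI') (rule Lim_transform_eventually)
qed

end
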